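(* Let $\{\gamma_n\}_{n=0}^\infty$ be a sequence of real numbers and $\{Q_k(x)\}_{k=0}^\infty$ a sequence of real polynomials such that $$T[L_n(x)]:=\left(\sum_{k=0}^\infty Q_k(x)D^k\right)L_n(x)=\gamma_nL_n(x)\qquad\text{for all } n\in\mathbb{N}_0.$$ Then for each $n\in\mathbb{N}_0$, $$Q_n(x)=\sum_{k=0}^{n}\left(\sum_{p=0}^{n} (-1)^{n-k} \binom{n-k}{p-k}\binom{p}{n-k}g_p^*(-1)\right)\frac{x^k}{k!},$$ where $\{g_k^*(x)\}_{k=0}^\infty$ are the reversed Jensen polynomials associated with $\{\gamma_n\}_{n=0}^\infty$.
   Context: $\mathbb{N}_0=\{0,1,2,\ldots\}$ and $D:=\frac{d}{dx}$. The Laguerre polynomials are $L_n(x)=\sum_{k=0}^n\frac{(-1)^k}{k!}\binom{n}{k}x^k$. The reversed Jensen polynomials associated with $\{\gamma_k\}_{k=0}^\infty$ are $g_n^*(x):=\sum_{k=0}^n\binom{n}{k}\gamma_kx^{n-k}$, $n\in\mathbb{N}_0$. Binomial coefficients $\binom{a}{b}$ are $0$ unless $0\le b\le a$. The operator $\sum_{k}Q_kD^k$ acts on polynomials, so only finitely many terms contribute. *)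

theory Defs
  imports
    Complex_Main
    "HOL-Computational_Algebra.Polynomial"
    "HOL-Library.Groups_Big_Fun"
begin

definition laguerre :: "nat \<Rightarrow> real poly" where
  "laguerre n = (\<Sum>k=0..n. monom ((-1) ^ k / fact k * of_nat (n choose k)) k)"

definition rev_jensen :: "(nat \<Rightarrow> real) \<Rightarrow> nat \<Rightarrow> real poly" where
  "rev_jensen \<gamma> n = (\<Sum>k=0..n. monom (of_nat (n choose k) * \<gamma> k) (n - k))"

text \<open>
  The binomial coefficient with integer arguments, equal to 0 unless \<open>0 \<le> b \<le> a\<close>.
  With natural-number arguments, truncated subtraction would turn
  \<open>n - k choose (p - k)\<close> into 1 instead of 0 for \<open>p < k\<close>.
\<close>

definition int_binom :: "int \<Rightarrow> int \<Rightarrow> real" where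
  "int_binom a b = (if 0 \<le> b \<and> b \<le> a then of_nat (nat a choose nat b) else 0)"

text \<open>
  \<open>Sum_any\<close> adds up the nonzero terms; for each polynomial there are only finitely many
  of them (lemma \<open>diff_op_eq_sum_degree\<close>), so this is the formal infinite sum.
\<close>

definition diff_op :: "(nat \<Rightarrow> real poly) \<Rightarrow> real poly \<Rightarrow> real poly" where
  "diff_op Q f = Sum_any (\<lambda>k. Q k * (pderiv ^^ k) f)"

lemma diff_op_eq_sum_degree:
  "diff_op Q f = (\<Sum>k=0..degree f. Q k * (pderiv ^^ k) f)"
proof -
  have "(pderiv ^^ k) f = 0" if "degree f < k" for k
    using that by (intro poly_eqI) (simp add: coeff_higher_pderiv coeff_eq_0)
  then have "{k. Q k * (pderiv ^^ k) f \<noteq> 0} \<subseteq> {0..degree f}"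
    by (metis (mono_tags, lifting) atLeastAtMost_iff le0 linorder_not_le mem_Collect_eq mult_zero_right subsetI)
  then show ?thesis
    unfolding diff_op_def by (intro Sum_any.expand_superset) auto
qed

end

theory Submission
  imports Defs
begin

text \<open>
  A differential operator is determined by its values on the Laguerre polynomials: since
  \<open>D\<^sup>n L\<^sub>n\<close> is the nonzero constant \<open>(-1)\<^sup>n\<close>, its coefficients can be recovered one after the other
  (\<open>diff_op_laguerre_cancel\<close>). It is therefore enough to exhibit one operator with eigenvalues \<open>\<gamma>\<^sub>n\<close>
  whose coefficients are those of the theorem.

  The number \<open>h\<^sub>p = g\<^sub>p\<^sup>*(-1)\<close> is the \<open>p\<close>-th forward difference of \<open>\<gamma>\<close> at \<open>0\<close>, so that Newton's formula
  writes \<open>\<gamma>\<^sub>n\<close> as the sum of \<open>h\<^sub>p\<close> times \<open>n choose p\<close> (\<open>binomial_transform_rev_jensen\<close>).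
  By linearity in \<open>h\<close>, this reduces the theorem to the eigenvalues \<open>n choose p\<close> for a fixed \<open>p\<close>, that is,
  to the operator whose coefficients are the terms with index \<open>p\<close> in the theorem, without \<open>h\<^sub>p\<close>.

  To compute this operator on \<open>L\<^sub>n\<close>, let \<open>e\<^sub>m = (-x)\<^sup>m / m!\<close>. In this basis \<open>L\<^sub>n\<close> is the sum of
  \<open>n choose m\<close> times \<open>e\<^sub>m\<close>, and \<open>D e\<^sub>m = - e\<^sub>m\<^sub>-\<^sub>1\<close>, so that signs and factorials turn
  into binomial coefficients. Vandermonde's identity then gives that \<open>e\<^sub>m\<close> is mapped to
  \<open>m choose p\<close> times the sum over \<open>j\<close> of \<open>p choose j\<close> times \<open>e\<^sub>m\<^sub>-\<^sub>j\<close>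
  (\<open>diff_op_choose_neg_exp_term\<close>). A second use of Vandermonde's identity sums these images to
  \<open>n choose p\<close> times \<open>L\<^sub>n\<close> (\<open>diff_op_choose_laguerre\<close>).
\<close>

section \<open>Sums of binomial coefficients\<close>

lemma sum_triangle_swap:
  fixes g :: "nat \<Rightarrow> nat \<Rightarrow> 'a::comm_monoid_add"
  shows "(\<Sum>k\<le>n. \<Sum>i\<le>k. g i (k - i)) = (\<Sum>j\<le>n. \<Sum>i\<le>n - j. g i j)"
proof -
  have "(\<Sum>j\<le>n. \<Sum>i\<le>n - j. g i j) = (\<Sum>(j, i)\<in>(SIGMA j:{..n}. {..n - j}). g i j)"
    by (simp add: sum.Sigma)
  also have "\<dots> = (\<Sum>(i, j)\<in>{(i, j). i + j \<le> n}. g i j)"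
    by (rule sum.reindex_bij_witness[where i="\<lambda>(i, j). (j, i)" and j="\<lambda>(i, j). (j, i)"]) auto
  finally show ?thesis
    by (simp add: sum.triangle_reindex_eq)
qed

text \<open>
  With \<open>n - m\<close> in place of \<open>m - p\<close>, trinomial revision also holds for \<open>m < p\<close>, where truncated
  subtraction would break it; sums over \<open>m\<close> then need no case distinction.
\<close>

lemma choose_mult_complement:
  fixes n m p :: nat
  assumes "m \<le> n" and "p \<le> n"
  shows "(n choose m) * (m choose p) = (n choose p) * ((n - p) choose (n - m))"
proof (cases "p \<le> m")
  case True
  have "(n - p) choose (m - p) = (n - p) choose (n - m)"
    using binomial_symmetric[of "m - p" "n - p"] assms True by simp
  then show ?thesis
    using choose_mult[OF True assms(1)] by simp
next
  case False
  then show ?thesis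
    using assms by (simp add: binomial_eq_0)
qed

text \<open>
  Vandermonde's identity for \<open>(m - j) + j\<close>. The conditional stands for a binomial coefficient that
  vanishes at negative lower index. The bound \<open>m - j\<close> comes from \<open>D\<^sup>k\<^sup>+\<^sup>j\<close>, which annihilates a
  monomial of degree \<open>m\<close> unless \<open>k + j \<le> m\<close>.
\<close>

lemma vandermonde_truncated:
  fixes j m p :: nat
  assumes "j \<le> m"
  shows "(\<Sum>k\<le>m - j. (if k \<le> p then j choose (p - k) else 0) * ((m - j) choose k)) = m choose p"
proof -
  have "(\<Sum>k\<le>m - j. (if k \<le> p then j choose (p - k) else 0) * ((m - j) choose k))
      = (\<Sum>k\<le>p. ((m - j) choose k) * (j choose (p - k)))"
    by (rule sum.mono_neutral_cong) auto
  then show ?thesis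
    using vandermonde[of "m - j" j p] assms by simp
qed

text \<open>
  The factor \<open>n choose p\<close> can be taken out by trinomial revision, and what is left is
  Vandermonde's identity for \<open>p + (n - p)\<close>.
\<close>

lemma sum_choose_triple:
  fixes n p r :: nat
  assumes "r \<le> n"
  shows "(\<Sum>j\<le>n - r. (n choose (r + j)) * ((r + j) choose p) * (p choose j))
    = (n choose p) * (n choose r)"
proof (cases "p \<le> n")
  case True
  have "(\<Sum>j\<le>n - r. (n choose (r + j)) * ((r + j) choose p) * (p choose j))
      = (\<Sum>j\<le>n - r. (n choose p) * ((p choose j) * ((n - p) choose (n - r - j))))"
    by (intro sum.cong refl) (use assms True in \<open>simp add: choose_mult_complement\<close>)
  also have "\<dots> = (n choose p) * (n choose (n - r))"
    using vandermonde[of p "n - p" "n - r"] True by (simp add: sum_distrib_left[symmetric])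
  finally show ?thesis
    using binomial_symmetric[OF assms] by simp
qed (use assms in \<open>simp add: binomial_eq_0\<close>)

lemma int_binom_of_nat: "int_binom (int a) (int b) = real (a choose b)"
  by (simp add: int_binom_def binomial_eq_0)

lemma int_binom_diff:
  fixes k n p :: nat
  assumes "k \<le> n"
  shows "int_binom (int n - int k) (int p - int k)
    = real (if k \<le> p then (n - k) choose (p - k) else 0)"
proof (cases "k \<le> p")
  case True
  then show ?thesis
    using assms int_binom_of_nat[of "n - k" "p - k"] by simp
qed (simp add: int_binom_def)

lemma poly_rev_jensen_minus_1:
  "poly (rev_jensen \<gamma> p) (-1) = (\<Sum>j\<le>p. real (p choose j) * (-1) ^ j * \<gamma> (p - j))"
proof -
  have "poly (rev_jensen \<gamma> p) (-1) = (\<Sum>k\<le>p. real (p choose k) * \<gamma> k * (-1) ^ (p - k))"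
    by (simp add: rev_jensen_def poly_sum poly_monom atLeast0AtMost)
  also have "\<dots> = (\<Sum>j\<le>p. real (p choose j) * (-1) ^ j * \<gamma> (p - j))"
    by (rule sum.reindex_bij_witness[where i="\<lambda>j. p - j" and j="\<lambda>j. p - j"])
       (auto simp: binomial_symmetric[symmetric])
  finally show ?thesis .
qed

text \<open>
  Binomial inversion: \<open>\<gamma>\<^sub>k\<close> enters the double sum with an alternating sum of binomial coefficients as
  its factor, and this sum vanishes unless \<open>k = n\<close>.
\<close>

lemma binomial_transform_rev_jensen:
  "(\<Sum>p\<le>n. real (n choose p) * poly (rev_jensen \<gamma> p) (-1)) = \<gamma> n"
proof -
  have alternating: "(\<Sum>j\<le>n - k. (-1) ^ j * real ((n choose (j + k)) * ((j + k) choose k)))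
      = (if k = n then 1 else 0)" if "k \<le> n" for k
  proof -
    have "(\<Sum>j\<le>n - k. (-1) ^ j * real ((n choose (j + k)) * ((j + k) choose k)))
        = real (n choose k) * (\<Sum>j\<le>n - k. (-1) ^ j * real ((n - k) choose j))"
      unfolding sum_distrib_left by (intro sum.cong refl) (use that in \<open>simp add: choose_mult\<close>)
    then show ?thesis
      using choose_alternating_sum[of "n - k", where 'a=real] that by auto
  qed
  \<comment> \<open>Writing \<open>p\<close> as \<open>j + (p - j)\<close> gives the summand the form in which the triangle can be swapped.\<close>
  have "(\<Sum>p\<le>n. real (n choose p) * poly (rev_jensen \<gamma> p) (-1))
      = (\<Sum>p\<le>n. \<Sum>j\<le>p. (-1) ^ j * real ((n choose (j + (p - j))) * ((j + (p - j)) choose (p - j)))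
          * \<gamma> (p - j))"
    unfolding poly_rev_jensen_minus_1 sum_distrib_left
    by (intro sum.cong refl) (simp add: binomial_symmetric[symmetric])
  also have "\<dots> = (\<Sum>k\<le>n. \<Sum>j\<le>n - k. (-1) ^ j * real ((n choose (j + k)) * ((j + k) choose k)) * \<gamma> k)"
    by (rule sum_triangle_swap)
  also have "\<dots> = (\<Sum>k\<le>n. (if k = n then 1 else 0) * \<gamma> k)"
    unfolding sum_distrib_right[symmetric] by (intro sum.cong refl) (simp add: alternating del: of_nat_mult)
  also have "\<dots> = \<gamma> n"
    by (simp add: if_distrib[of "\<lambda>x. x * _"] cong: if_cong)
  finally show ?thesis .
qed

section \<open>Differential operators applied to Laguerre polynomials\<close>

lemma smult_sum_right: "smult c (\<Sum>i\<in>S. f i) = (\<Sum>i\<in>S. smult c (f i))"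
  by (induction S rule: infinite_finite_induct) (simp_all add: smult_add_right)

lemma higher_pderiv_eq_0:
  fixes f :: "real poly"
  assumes "degree f < k"
  shows "(pderiv ^^ k) f = 0"
  using assms by (intro poly_eqI) (simp add: coeff_higher_pderiv coeff_eq_0)

text \<open>
  A bound that does not depend on \<open>f\<close> makes the operator visibly linear in \<open>f\<close>
  and lets it be exchanged with the sum that expands a Laguerre polynomial.
\<close>

lemma diff_op_eq_sum:
  assumes "degree f \<le> N"
  shows "diff_op Q f = (\<Sum>k\<le>N. Q k * (pderiv ^^ k) f)"
  unfolding diff_op_eq_sum_degree using assms
  by (intro sum.mono_neutral_left) (auto simp: not_le higher_pderiv_eq_0)

text \<open>The terms of the power series of \<open>exp (-x)\<close>, which differentiation shifts up to a sign.\<close>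

definition neg_exp_term :: "nat \<Rightarrow> real poly" where
  "neg_exp_term m = monom ((-1) ^ m / fact m) m"

lemma degree_neg_exp_term: "degree (neg_exp_term m) = m"
  by (simp add: neg_exp_term_def degree_monom_eq)

lemma higher_pderiv_neg_exp_term:
  "k \<le> m \<Longrightarrow> (pderiv ^^ k) (neg_exp_term m) = smult ((-1) ^ k) (neg_exp_term (m - k))"
proof (induction k)
  case (Suc k)
  then obtain d where d: "m = Suc (k + d)"
    by (auto dest: le_Suc_ex)
  have "(pderiv ^^ Suc k) (neg_exp_term m) = pderiv (smult ((-1) ^ k) (neg_exp_term (m - k)))"
    using Suc by simp
  also have "\<dots> = smult ((-1) ^ Suc k) (neg_exp_term (m - Suc k))"
    by (simp add: d neg_exp_term_def pderiv_smult pderiv_monom smult_monom Suc_diff_le field_simps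
        del: of_nat_Suc)
  finally show ?case .
qed simp

lemma laguerre_eq_sum_neg_exp_term:
  "laguerre n = (\<Sum>m\<le>n. smult (real (n choose m)) (neg_exp_term m))"
  by (simp add: laguerre_def neg_exp_term_def smult_monom atLeast0AtMost mult.commute)

lemma degree_laguerre_le: "degree (laguerre n) \<le> n"
  unfolding laguerre_eq_sum_neg_exp_term
  by (intro degree_sum_le)
     (auto intro: order.trans[OF degree_smult_le] simp: degree_neg_exp_term)

lemma higher_pderiv_laguerre_self: "(pderiv ^^ n) (laguerre n) = [:(-1) ^ n:]"
proof -
  have "(pderiv ^^ n) (neg_exp_term m) = 0" if "m < n" for m
    using that by (simp add: higher_pderiv_eq_0 degree_neg_exp_term)
  then have "(pderiv ^^ n) (laguerre n) = (\<Sum>m\<in>{n}. smult (real (n choose m)) ((pderiv ^^ n) (neg_exp_term m)))"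
    unfolding laguerre_eq_sum_neg_exp_term higher_pderiv_sum higher_pderiv_smult
    by (intro sum.mono_neutral_right) auto
  then show ?thesis
    by (simp add: higher_pderiv_neg_exp_term) (simp add: neg_exp_term_def monom_0)
qed

text \<open>
  The system of equations for the coefficients is triangular: in the value at \<open>L\<^sub>n\<close> only the coefficients
  up to \<open>n\<close> occur, and the last one is multiplied by a nonzero constant.
\<close>

lemma diff_op_laguerre_cancel:
  assumes "\<And>n. diff_op P (laguerre n) = diff_op Q (laguerre n)"
  shows "P n = Q n"
proof (induction n rule: less_induct)
  case (less n)
  have split: "diff_op R (laguerre n)
      = (\<Sum>k<n. R k * (pderiv ^^ k) (laguerre n)) + R n * [:(-1) ^ n:]" for R
    using diff_op_eq_sum[OF degree_laguerre_le]
    by (simp add: higher_pderiv_laguerre_self lessThan_Suc_atMost[symmetric] del: mult_pCons_right)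
  have "P n * [:(-1) ^ n:] = Q n * [:(-1) ^ n:]"
    using assms[of n] less unfolding split by simp
  moreover have "[:(-1) ^ n :: real:] \<noteq> 0"
    by simp
  ultimately show ?case
    by (metis mult_cancel_right)
qed

section \<open>The operator with binomial eigenvalues\<close>

text \<open>
  The contribution of \<open>g\<^sub>p\<^sup>*(-1)\<close> to the coefficient of \<open>D\<^sup>n\<close>. The conditional replaces the truncated
  subtraction \<open>p - k\<close> by a binomial coefficient that vanishes for \<open>p < k\<close>.
\<close>

definition choose_op_coeff :: "nat \<Rightarrow> nat \<Rightarrow> real poly" where
  "choose_op_coeff p n = (\<Sum>k\<le>n. monom ((-1) ^ (n - k)
     * real (if k \<le> p then (n - k) choose (p - k) else 0) * real (p choose (n - k)) / fact k) k)"

lemma choose_op_coeff_eq_0: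
  assumes "n < p"
  shows "choose_op_coeff p n = 0"
  unfolding choose_op_coeff_def by (intro sum.neutral ballI) (use assms in \<open>simp add: binomial_eq_0\<close>)

text \<open>
  The term in \<open>x\<^sup>k\<close> of the coefficient of \<open>D\<^sup>k\<^sup>+\<^sup>j\<close> maps \<open>e\<^sub>m\<close> to a multiple of \<open>e\<^sub>m\<^sub>-\<^sub>j\<close>, where the factorials
  combine to \<open>m - j choose k\<close> and the signs cancel. Hence \<open>j\<close> decides which \<open>e\<^sub>m\<^sub>-\<^sub>j\<close> is hit, and the sum
  over \<open>k\<close> is a Vandermonde sum whose value \<open>m choose p\<close> is the same for all \<open>j\<close>.
\<close>

lemma diff_op_choose_neg_exp_term:
  "diff_op (choose_op_coeff p) (neg_exp_term m)
    = (\<Sum>j\<le>m. smult (real ((m choose p) * (p choose j))) (neg_exp_term (m - j)))"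
proof -
  define g where "g k j = smult (real ((if k \<le> p then j choose (p - k) else 0) * ((m - j) choose k)
    * (p choose j))) (neg_exp_term (m - j))" for k j
  \<comment> \<open>\<open>a\<close> and \<open>b\<close> stand for the two binomial coefficients in \<open>choose_op_coeff\<close>.\<close>
  have term_eq: "monom ((-1) ^ j * a * b / fact k) k * smult ((-1) ^ (k + j)) (neg_exp_term (m - (k + j)))
      = smult (a * real ((m - j) choose k) * b) (neg_exp_term (m - j))" if le: "k + j \<le> m" for a b :: real and k j
  proof -
    obtain d where d: "m = k + j + d"
      using le le_Suc_ex by blast
    have choose: "real ((k + d) choose k) = fact (k + d) / (fact k * fact d)"
      by (simp add: binomial_fact)
    have sign: "(-1 :: real) ^ j * (-1) ^ (k + j) = (-1) ^ k"
      by (simp add: power_add mult.left_commute[of "(-1) ^ j"] power_mult_distrib[symmetric])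
    have "(-1) ^ j * a * b / fact k * ((-1) ^ (k + j) * ((-1) ^ d / fact d))
        = ((-1) ^ j * (-1) ^ (k + j)) * (-1) ^ d * (a * b / (fact k * fact d))"
      by simp
    also have "\<dots> = a * real ((k + d) choose k) * b * ((-1) ^ (k + d) / fact (k + d))"
      unfolding sign choose by (simp add: power_add)
    finally show ?thesis
      by (simp add: d neg_exp_term_def smult_monom mult_monom)
  qed
  have "diff_op (choose_op_coeff p) (neg_exp_term m)
      = (\<Sum>n\<le>m. choose_op_coeff p n * smult ((-1) ^ n) (neg_exp_term (m - n)))"
    using diff_op_eq_sum[of "neg_exp_term m" m]
    by (simp add: degree_neg_exp_term higher_pderiv_neg_exp_term)
  also have "\<dots> = (\<Sum>n\<le>m. \<Sum>k\<le>n. g k (n - k))"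
    unfolding choose_op_coeff_def sum_distrib_right g_def
  proof (intro sum.cong refl)
    fix n k assume "n \<in> {..m}" "k \<in> {..n}"
    then show "monom ((-1) ^ (n - k) * real (if k \<le> p then n - k choose (p - k) else 0)
            * real (p choose (n - k)) / fact k) k * smult ((-1) ^ n) (neg_exp_term (m - n))
        = smult (real ((if k \<le> p then n - k choose (p - k) else 0) * (m - (n - k) choose k)
            * (p choose (n - k)))) (neg_exp_term (m - (n - k)))"
      using term_eq[of k "n - k"] by simp
  qed
  also have "\<dots> = (\<Sum>j\<le>m. \<Sum>k\<le>m - j. g k j)"
    by (rule sum_triangle_swap)
  also have "\<dots> = (\<Sum>j\<le>m. smult (real ((m choose p) * (p choose j))) (neg_exp_term (m - j)))"
    unfolding g_def smult_sum[symmetric] of_nat_sum[symmetric] sum_distrib_right[symmetric]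
    by (intro sum.cong refl) (simp only: vandermonde_truncated atMost_iff)
  finally show ?thesis .
qed

lemma diff_op_choose_laguerre:
  "diff_op (choose_op_coeff p) (laguerre n) = smult (real (n choose p)) (laguerre n)"
proof -
  have "diff_op (choose_op_coeff p) (laguerre n)
      = (\<Sum>m\<le>n. smult (real (n choose m)) (\<Sum>k\<le>n. choose_op_coeff p k * (pderiv ^^ k) (neg_exp_term m)))"
    unfolding diff_op_eq_sum[OF degree_laguerre_le]
    unfolding laguerre_eq_sum_neg_exp_term higher_pderiv_sum higher_pderiv_smult sum_distrib_left smult_sum_right
    by (subst sum.swap) simp
  also have "\<dots> = (\<Sum>m\<le>n. smult (real (n choose m)) (diff_op (choose_op_coeff p) (neg_exp_term m)))"
    by (intro sum.cong refl arg_cong2[where f=smult] diff_op_eq_sum[symmetric])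
       (simp add: degree_neg_exp_term)
  also have "\<dots> = (\<Sum>m\<le>n. \<Sum>j\<le>m. smult (real ((n choose (m - j + j)) * ((m - j + j) choose p) * (p choose j)))
      (neg_exp_term (m - j)))"
    unfolding diff_op_choose_neg_exp_term smult_sum_right
    by (intro sum.cong refl) (simp add: mult.assoc)
  also have "\<dots> = (\<Sum>r\<le>n. \<Sum>j\<le>n - r. smult (real ((n choose (r + j)) * ((r + j) choose p) * (p choose j)))
      (neg_exp_term r))"
    by (rule sum_triangle_swap)
  also have "\<dots> = (\<Sum>r\<le>n. smult (real ((n choose p) * (n choose r))) (neg_exp_term r))"
    unfolding smult_sum[symmetric] of_nat_sum[symmetric]
    by (intro sum.cong refl) (simp only: sum_choose_triple atMost_iff)
  also have "\<dots> = smult (real (n choose p)) (laguerre n)"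
    by (simp add: laguerre_eq_sum_neg_exp_term smult_sum_right)
  finally show ?thesis .
qed

text \<open>
  In the coefficient of \<open>D\<^sup>n\<close> the summation over \<open>p\<close> may stop at \<open>n\<close>, because the operator with index \<open>p\<close>
  has no coefficients below \<open>D\<^sup>p\<close>; the superposition of infinitely many operators is thus well defined.
\<close>

lemma diff_op_sum_choose_laguerre:
  fixes h :: "nat \<Rightarrow> real"
  shows "diff_op (\<lambda>n. \<Sum>p\<le>n. smult (h p) (choose_op_coeff p n)) (laguerre n)
    = smult (\<Sum>p\<le>n. real (n choose p) * h p) (laguerre n)"
proof -
  have "(\<Sum>p\<le>k. smult (h p) (choose_op_coeff p k)) = (\<Sum>p\<le>n. smult (h p) (choose_op_coeff p k))"
    if "k \<le> n" for k
    using that by (intro sum.mono_neutral_left) (auto simp: choose_op_coeff_eq_0)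
  then have "diff_op (\<lambda>n. \<Sum>p\<le>n. smult (h p) (choose_op_coeff p n)) (laguerre n)
      = (\<Sum>k\<le>n. (\<Sum>p\<le>n. smult (h p) (choose_op_coeff p k)) * (pderiv ^^ k) (laguerre n))"
    unfolding diff_op_eq_sum[OF degree_laguerre_le] by simp
  also have "\<dots> = (\<Sum>p\<le>n. smult (h p) (diff_op (choose_op_coeff p) (laguerre n)))"
    unfolding diff_op_eq_sum[OF degree_laguerre_le] sum_distrib_right smult_sum_right
    by (subst sum.swap) simp
  also have "\<dots> = smult (\<Sum>p\<le>n. real (n choose p) * h p) (laguerre n)"
    by (simp add: diff_op_choose_laguerre smult_sum mult.commute)
  finally show ?thesis .
qed

theorem theorem47:
  fixes \<gamma> :: "nat \<Rightarrow> real" and Q :: "nat \<Rightarrow> real poly"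
  assumes "\<And>n. diff_op Q (laguerre n) = smult (\<gamma> n) (laguerre n)"
  shows "Q n = (\<Sum>k=0..n. monom
           ((\<Sum>p=0..n. (-1) ^ (n - k) * int_binom (int n - int k) (int p - int k)
               * int_binom (int p) (int n - int k) * poly (rev_jensen \<gamma> p) (-1)) / fact k) k)"
proof -
  let ?h = "\<lambda>p. poly (rev_jensen \<gamma> p) (-1)"
  have "Q n = (\<Sum>p\<le>n. smult (?h p) (choose_op_coeff p n))"
    by (rule diff_op_laguerre_cancel)
       (simp add: assms diff_op_sum_choose_laguerre binomial_transform_rev_jensen)
  also have "\<dots> = (\<Sum>k\<le>n. \<Sum>p\<le>n. monom ((-1) ^ (n - k)
      * real (if k \<le> p then (n - k) choose (p - k) else 0) * real (p choose (n - k)) / fact k * ?h p) k)"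
    unfolding choose_op_coeff_def smult_sum_right smult_monom
    by (subst sum.swap) (simp add: mult.commute)
  also have "\<dots> = (\<Sum>k\<le>n. monom ((\<Sum>p\<le>n. (-1) ^ (n - k) * int_binom (int n - int k) (int p - int k)
      * int_binom (int p) (int n - int k) * ?h p) / fact k) k)"
  proof (intro sum.cong refl)
    fix k assume "k \<in> {..n}"
    then have k: "k \<le> n" by simp
    have "int_binom (int p) (int n - int k) = real (p choose (n - k))" for p
      using int_binom_of_nat[of p "n - k"] k by simp
    then show "(\<Sum>p\<le>n. monom ((-1) ^ (n - k)
        * real (if k \<le> p then (n - k) choose (p - k) else 0) * real (p choose (n - k)) / fact k * ?h p) k)
      = monom ((\<Sum>p\<le>n. (-1) ^ (n - k) * int_binom (int n - int k) (int p - int k)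
        * int_binom (int p) (int n - int k) * ?h p) / fact k) k"
      by (simp add: int_binom_diff[OF k] monom_sum sum_divide_distrib)
  qed
  finally show ?thesis
    by (simp add: atLeast0AtMost)
qed

end
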